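(* For $j=1,2$ consider the port-Hamiltonian systems with delay terms $$\dot x_j(t)=(J_j-R_j)H_jx_j(t)+\sum_{i=1}^q Z_{i,j}H_jx_j(t-\tau_{i,j})+B_ju_j(t),\qquad y_j(t)=B_j^\top H_jx_j(t),$$ where $J_j=-J_j^\top$, $R_j\ge0$, $H_j>0$, $Z_{i,j}$ and $B_j$ are real matrices of compatible sizes ($u_1,u_2,y_1,y_2$ all taking values in the same $\mathbb{R}^m$) and $0<\tau_{1,j}\le\dots\le\tau_{q,j}$ are fixed delays. If these systems are passive for these fixed delays with storage functions $\mathcal{S}_1$ and $\mathcal{S}_2$, respectively, then the negative feedback interconnection $$u_1=v-y_2,\qquad u_2=y_1,$$ with external input $v$ (and output $y_1$) is passive with storage function $\mathcal{S}=\mathcal{S}_1+\mathcal{S}_2$, i.e. $\mathcal{S}$ evaluated on the history of $(x_1,x_2)$ is the sum of $\mathcal{S}_1$ evaluated on the history of $x_1$ and $\mathcal{S}_2$ evaluated on the history of $x_2$.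
   Context: $R\ge 0$ ($H>0$) means symmetric and positive semi-definite (positive definite). For $t\ge 0$, $x_t$ denotes the function $x_t(s)=x(t+s)$, $s\in[-\tau_q,0]$. A linear delay system with state $x(t)\in\mathbb{R}^n$, input $u$, output $y$, delays $0<\tau_1\le\dots\le\tau_q$ and initial condition $x(t)=\phi(t)$ on $[-\tau_q,0]$ is called passive for these fixed delays if there exists a storage function $\mathcal{S}:C^1([-\tau_q,0],\mathbb{R}^n)\to[0,\infty)$ with $\mathcal{S}(0)=0$ such that for all $0\le t_0\le t_1<\infty$ and all initial histories $\phi\in C^1([-\tau_q,0],\mathbb{R}^n)$ $$\mathcal{S}(x_{t_1})-\mathcal{S}(x_{t_0})\le\int_{t_0}^{t_1}y(s)^\top u(s)\,\mathrm{d}s ,$$ where $x$ is the solution of the system with history $\phi$ (and input $u$).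
   Formalization: Storage functions are taken on all functions on the history interval rather than only C^1 ones, since x_t generally has a derivative jump at time 0 and S(x_t) would be undefined; inputs are taken continuous and solutions classical. *)

theory Defs
  imports "HOL-Analysis.Analysis"
begin

definition pos_semidef :: "real^'n^'n \<Rightarrow> bool" where
  "pos_semidef A \<longleftrightarrow> transpose A = A \<and> (\<forall>x. 0 \<le> x \<bullet> (A *v x))"

definition pos_def :: "real^'n^'n \<Rightarrow> bool" where
  "pos_def A \<longleftrightarrow> transpose A = A \<and> (\<forall>x. x \<noteq> 0 \<longrightarrow> 0 < x \<bullet> (A *v x))"

(* One-sided derivatives at endpoints.  The library's C1_differentiable_on asks for two-sided
   derivatives and is therefore unsuitable for histories given on a closed interval only. *)
definition C1_on :: "real set \<Rightarrow> (real \<Rightarrow> 'a::real_normed_vector) \<Rightarrow> bool" where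
  "C1_on I f \<longleftrightarrow>
     (\<exists>f'. continuous_on I f' \<and> (\<forall>t\<in>I. (f has_vector_derivative f' t) (at t within I)))"

definition history :: "(real \<Rightarrow> 'x) \<Rightarrow> real \<Rightarrow> real \<Rightarrow> 'x" where
  "history x t = (\<lambda>s. x (t + s))"

(* A functional of functions on [-r,0] is encoded as a functional of total functions that
   depends only on the restriction to [-r,0].  It is not restricted to C^1 arguments: for a C^1
   initial history phi the solution is C^1 on [-r,0] and on [0,\<infinity>), but its derivative
   jumps at 0 unless phi is compatible with the equation there, so for 0 < t < r the segment
   x_t is in general only piecewise C^1, and the dissipation inequality evaluates S at it. *)
definition storage_function :: "real \<Rightarrow> ((real \<Rightarrow> 'x::real_normed_vector) \<Rightarrow> real) \<Rightarrow> bool" where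
  "storage_function r S \<longleftrightarrow>
     (\<forall>\<phi> \<psi>. (\<forall>s\<in>{-r..0}. \<phi> s = \<psi> s) \<longrightarrow> S \<phi> = S \<psi>) \<and>
     (\<forall>\<phi>. 0 \<le> S \<phi>) \<and> S (\<lambda>_. 0) = 0"

(* The equations of a system on [0,\<infinity>), as a relation between input, state and output;
   the initial condition on [-r,0] is kept separate. *)
type_synonym ('u, 'x) dynamics = "(real \<Rightarrow> 'u) \<Rightarrow> (real \<Rightarrow> 'x) \<Rightarrow> (real \<Rightarrow> 'u) \<Rightarrow> bool"

definition ph_delay_dynamics ::
  "nat \<Rightarrow> real^'n^'n \<Rightarrow> real^'n^'n \<Rightarrow> real^'n^'n \<Rightarrow> (nat \<Rightarrow> real^'n^'n) \<Rightarrow> real^'m^'n \<Rightarrow> (nat \<Rightarrow> real)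
    \<Rightarrow> (real^'m, real^'n) dynamics" where
  "ph_delay_dynamics q J R H Z B \<tau> u x y \<longleftrightarrow>
     (\<forall>t\<ge>0.
        (x has_vector_derivative
           ((J - R) ** H) *v x t + (\<Sum>i=1..q. (Z i ** H) *v x (t - \<tau> i)) + B *v u t)
          (at t within {0..}) \<and>
        y t = (transpose B ** H) *v x t)"

definition negative_feedback ::
  "('u::real_normed_vector, 'x1) dynamics \<Rightarrow> ('u, 'x2) dynamics \<Rightarrow> ('u, 'x1 \<times> 'x2) dynamics" where
  "negative_feedback \<Sigma>1 \<Sigma>2 v x y \<longleftrightarrow>
     (\<exists>u1 y1 u2 y2.
        \<Sigma>1 u1 (fst \<circ> x) y1 \<and> \<Sigma>2 u2 (snd \<circ> x) y2 \<and>
        (\<forall>t\<ge>0. u1 t = v t - y2 t \<and> u2 t = y1 t \<and> y t = y1 t))"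

(* r is the largest delay.  Inputs are continuous, so that solutions are classical. *)
definition passive_with ::
  "real \<Rightarrow> ('u::real_inner, 'x::real_normed_vector) dynamics \<Rightarrow> ((real \<Rightarrow> 'x) \<Rightarrow> real) \<Rightarrow> bool" where
  "passive_with r \<Sigma> S \<longleftrightarrow>
     storage_function r S \<and>
     (\<forall>\<phi> u x y. C1_on {-r..0} \<phi> \<longrightarrow> continuous_on {0..} u \<longrightarrow>
        (\<forall>t\<in>{-r..0}. x t = \<phi> t) \<longrightarrow> \<Sigma> u x y \<longrightarrow>
        (\<forall>t0 t1. 0 \<le> t0 \<longrightarrow> t0 \<le> t1 \<longrightarrow>
           S (history x t1) - S (history x t0) \<le> integral {t0..t1} (\<lambda>s. y s \<bullet> u s)))"

end

theory Submission
  imports Defs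
begin

text \<open>Under the interconnection the supply rates of the two subsystems add up to the external one,
  \<open>y1 \<bullet> (v - y2) + y2 \<bullet> y1 = y1 \<bullet> v\<close>. Adding the two dissipation inequalities therefore gives
  the claim, provided the internal inputs \<open>v - y2\<close> and \<open>y1\<close> are admissible, i.e. continuous; they
  are, because the outputs are linear functions of the differentiable states.\<close>

lemma C1_on_subset:
  assumes "C1_on I f" and "J \<subseteq> I"
  shows "C1_on J f"
  using assms unfolding C1_on_def
  by (meson continuous_on_subset has_vector_derivative_within_subset subsetD)

text \<open>Meant for the projections \<open>fst\<close> and \<open>snd\<close>, which extract the
  subsystem states from the joint state.\<close>

lemma C1_on_bounded_linear:
  assumes "bounded_linear g" and "C1_on I f"
  shows "C1_on I (g \<circ> f)"
proof -
  obtain f' where f': "continuous_on I f'"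
    "\<And>t. t \<in> I \<Longrightarrow> (f has_vector_derivative f' t) (at t within I)"
    using assms(2) unfolding C1_on_def by blast
  have "continuous_on I (\<lambda>t. g (f' t))"
    by (rule bounded_linear.continuous_on[OF assms(1) f'(1)])
  moreover have "(g \<circ> f has_vector_derivative g (f' t)) (at t within I)" if "t \<in> I" for t
    using bounded_linear.has_vector_derivative[OF assms(1) f'(2)[OF that]] by (simp add: o_def)
  ultimately show ?thesis
    unfolding C1_on_def by blast
qed

text \<open>Differentiability of the state on \<open>{0..}\<close> gives continuity, and the output
  map is linear. Continuity of \<open>u\<close> must not enter here: in the loop it is deduced from
  that of the outputs, so assuming it would be circular.\<close>

lemma ph_delay_dynamics_continuous_output:
  assumes "ph_delay_dynamics q J R H Z B \<tau> u x y"
  shows "continuous_on {0..} y"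
proof -
  have "continuous_on {0..} x"
    using assms unfolding ph_delay_dynamics_def
    by (meson atLeast_iff continuous_on_eq_continuous_within has_vector_derivative_continuous)
  then have "continuous_on {0..} (\<lambda>t. (transpose B ** H) *v x t)"
    by (rule bounded_linear.continuous_on[OF matrix_vector_mul_bounded_linear])
  then show ?thesis
    using assms unfolding ph_delay_dynamics_def by (subst continuous_on_cong) auto
qed

lemma history_comp: "f \<circ> history x t = history (f \<circ> x) t"
  by (simp add: history_def o_def)

text \<open>The state serves as its own initial history, so no separate \<open>\<phi>\<close> has to
  be supplied.\<close>

lemma passive_withD:
  assumes "passive_with r \<Sigma> S" and "C1_on {-r..0} x" and "continuous_on {0..} u"
    and "\<Sigma> u x y" and "0 \<le> t0" and "t0 \<le> t1"
  shows "S (history x t1) - S (history x t0) \<le> integral {t0..t1} (\<lambda>s. y s \<bullet> u s)"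
  using assms unfolding passive_with_def by blast

text \<open>Agreement on the longer of the two intervals implies agreement on both, hence the
  \<open>max\<close>.\<close>

lemma storage_function_sum:
  assumes "storage_function r1 S1" and "storage_function r2 S2"
  shows "storage_function (max r1 r2) (\<lambda>\<phi>. S1 (fst \<circ> \<phi>) + S2 (snd \<circ> \<phi>))"
proof -
  have "S1 (fst \<circ> \<phi>) = S1 (fst \<circ> \<psi>)" "S2 (snd \<circ> \<phi>) = S2 (snd \<circ> \<psi>)"
    if "\<forall>s\<in>{-max r1 r2..0}. \<phi> s = \<psi> s" for \<phi> \<psi> :: "real \<Rightarrow> 'a \<times> 'b"
  proof -
    have "\<forall>s\<in>{-r1..0}. (fst \<circ> \<phi>) s = (fst \<circ> \<psi>) s" "\<forall>s\<in>{-r2..0}. (snd \<circ> \<phi>) s = (snd \<circ> \<psi>) s"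
      using that by auto
    then show "S1 (fst \<circ> \<phi>) = S1 (fst \<circ> \<psi>)" "S2 (snd \<circ> \<phi>) = S2 (snd \<circ> \<psi>)"
      using assms unfolding storage_function_def by blast+
  qed
  then show ?thesis
    using assms unfolding storage_function_def by (simp add: o_def) metis
qed

text \<open>The argument is independent of the form of the equations. Continuity of the outputs
  makes the internal inputs admissible and the supply rates integrable.\<close>

lemma passive_with_negative_feedback:
  fixes \<Sigma>1 :: "('u::real_inner, 'x1::real_normed_vector) dynamics"
    and \<Sigma>2 :: "('u, 'x2::real_normed_vector) dynamics"
  assumes passive1: "passive_with r1 \<Sigma>1 S1" and passive2: "passive_with r2 \<Sigma>2 S2"
    and output1: "\<And>u x y. \<Sigma>1 u x y \<Longrightarrow> continuous_on {0..} y"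
    and output2: "\<And>u x y. \<Sigma>2 u x y \<Longrightarrow> continuous_on {0..} y"
  shows "passive_with (max r1 r2) (negative_feedback \<Sigma>1 \<Sigma>2)
    (\<lambda>\<phi>. S1 (fst \<circ> \<phi>) + S2 (snd \<circ> \<phi>))"
  unfolding passive_with_def
proof (intro conjI allI impI)
  show "storage_function (max r1 r2) (\<lambda>\<phi>. S1 (fst \<circ> \<phi>) + S2 (snd \<circ> \<phi>))"
    using passive1 passive2 unfolding passive_with_def by (blast intro: storage_function_sum)
next
  fix \<phi> x :: "real \<Rightarrow> 'x1 \<times> 'x2" and v y :: "real \<Rightarrow> 'u" and t0 t1 :: real
  assume \<phi>: "C1_on {-max r1 r2..0} \<phi>" and v: "continuous_on {0..} v"
    and x: "\<forall>t\<in>{-max r1 r2..0}. x t = \<phi> t" and fb: "negative_feedback \<Sigma>1 \<Sigma>2 v x y"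
    and t: "0 \<le> t0" "t0 \<le> t1"
  obtain u1 y1 u2 y2 where dyn: "\<Sigma>1 u1 (fst \<circ> x) y1" "\<Sigma>2 u2 (snd \<circ> x) y2"
    and eq: "\<And>t. 0 \<le> t \<Longrightarrow> u1 t = v t - y2 t" "\<And>t. 0 \<le> t \<Longrightarrow> u2 t = y1 t"
      "\<And>t. 0 \<le> t \<Longrightarrow> y t = y1 t"
    using fb unfolding negative_feedback_def by blast
  have y: "continuous_on {0..} y1" "continuous_on {0..} y2"
    using dyn output1 output2 by blast+
  have "continuous_on {0..} (\<lambda>t. v t - y2 t)"
    by (intro continuous_intros v y)
  \<comment> \<open>The feedback law fixes \<open>u1\<close> and \<open>u2\<close> only for
    nonnegative times, so continuity is transferred by agreement on \<open>{0..}\<close>.\<close>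
  then have u1: "continuous_on {0..} u1"
    by (rule continuous_on_eq) (simp add: eq)
  have u2: "continuous_on {0..} u2"
    using y(1) by (rule continuous_on_eq) (simp add: eq)
  \<comment> \<open>Derivatives within the interval depend only on the values there, where
    \<open>x\<close> equals \<open>\<phi>\<close>.\<close>
  have C1: "C1_on {-max r1 r2..0} x"
    using \<phi> x unfolding C1_on_def by (metis has_vector_derivative_transform)
  then have hist: "C1_on {-r1..0} (fst \<circ> x)" "C1_on {-r2..0} (snd \<circ> x)"
    by (auto intro!: C1_on_bounded_linear bounded_linear_fst bounded_linear_snd
        C1_on_subset[OF C1])
  \<comment> \<open>\<open>integral\<close> is 0 for a non-integrable function, so additivity
    requires integrability of each supply rate.\<close>
  have "(\<lambda>s. f s \<bullet> g s) integrable_on {t0..t1}"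
    if "continuous_on {0..} f" "continuous_on {0..} g" for f g :: "real \<Rightarrow> 'u"
  proof (rule integrable_continuous_real)
    have "continuous_on {0..} (\<lambda>s. f s \<bullet> g s)"
      using that by (rule continuous_on_inner)
    then show "continuous_on {t0..t1} (\<lambda>s. f s \<bullet> g s)"
      by (rule continuous_on_subset) (use t in auto)
  qed
  from this[OF y(1) u1] this[OF y(2) u2]
  have int: "(\<lambda>s. y1 s \<bullet> u1 s) integrable_on {t0..t1}"
    "(\<lambda>s. y2 s \<bullet> u2 s) integrable_on {t0..t1}"
    .
  have "integral {t0..t1} (\<lambda>s. y1 s \<bullet> u1 s) + integral {t0..t1} (\<lambda>s. y2 s \<bullet> u2 s)
      = integral {t0..t1} (\<lambda>s. y1 s \<bullet> u1 s + y2 s \<bullet> u2 s)"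
    by (rule integral_add[OF int, symmetric])
  \<comment> \<open>Since \<open>0 \<le> t0\<close>, the feedback equations hold throughout the
    interval; the cross terms cancel by symmetry of the inner product.\<close>
  also have "\<dots> = integral {t0..t1} (\<lambda>s. y s \<bullet> v s)"
    using t by (intro integral_cong) (simp add: eq inner_diff_right inner_commute)
  finally show "S1 (fst \<circ> history x t1) + S2 (snd \<circ> history x t1)
      - (S1 (fst \<circ> history x t0) + S2 (snd \<circ> history x t0)) \<le> integral {t0..t1} (\<lambda>s. y s \<bullet> v s)"
    using passive_withD[OF passive1, OF hist(1) u1 dyn(1) t]
      passive_withD[OF passive2, OF hist(2) u2 dyn(2) t]
    unfolding history_comp by linarith
qed

theorem proposition2p8:
  fixes J1 R1 H1 :: "real^'n1^'n1" and Z1 :: "nat \<Rightarrow> real^'n1^'n1" and B1 :: "real^'m^'n1"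
    and J2 R2 H2 :: "real^'n2^'n2" and Z2 :: "nat \<Rightarrow> real^'n2^'n2" and B2 :: "real^'m^'n2"
    and \<tau>1 \<tau>2 :: "nat \<Rightarrow> real" and q :: nat
    and S1 :: "(real \<Rightarrow> real^'n1) \<Rightarrow> real" and S2 :: "(real \<Rightarrow> real^'n2) \<Rightarrow> real"
  assumes "1 \<le> q"
    and "J1 = - transpose J1" and "pos_semidef R1" and "pos_def H1"
    and "J2 = - transpose J2" and "pos_semidef R2" and "pos_def H2"
    and "0 < \<tau>1 1" and "\<forall>i j. 1 \<le> i \<longrightarrow> i \<le> j \<longrightarrow> j \<le> q \<longrightarrow> \<tau>1 i \<le> \<tau>1 j"
    and "0 < \<tau>2 1" and "\<forall>i j. 1 \<le> i \<longrightarrow> i \<le> j \<longrightarrow> j \<le> q \<longrightarrow> \<tau>2 i \<le> \<tau>2 j"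
    and "passive_with (\<tau>1 q) (ph_delay_dynamics q J1 R1 H1 Z1 B1 \<tau>1) S1"
    and "passive_with (\<tau>2 q) (ph_delay_dynamics q J2 R2 H2 Z2 B2 \<tau>2) S2"
  shows "passive_with (max (\<tau>1 q) (\<tau>2 q))
           (negative_feedback
              (ph_delay_dynamics q J1 R1 H1 Z1 B1 \<tau>1)
              (ph_delay_dynamics q J2 R2 H2 Z2 B2 \<tau>2))
           (\<lambda>\<phi>. S1 (fst \<circ> \<phi>) + S2 (snd \<circ> \<phi>))"
  using assms(12,13) by (rule passive_with_negative_feedback)
    (fact ph_delay_dynamics_continuous_output)+

end
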